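(* Let $n\ge3$ and let $G$ be a finite simple graph with vertex set $[1,n]$ and no isolated vertices. Let $G+\{0\}$ be the graph obtained from $G$ by adding a new vertex $0$ adjacent to every vertex of $G$. Then $\max\{t(1,n)+1,\ t(G)\}\le t(G+\{0\})\le t(G)+1$.
   Context: For a finite simple graph $H$, a $H$-CFF$(t,|V(H)|)$ is a family of subsets $B_v\subseteq[1,t]=\{1,\dots,t\}$, one for each vertex $v$, such that for every edge $\{a,b\}$: (i) $B_a\not\subseteq B_b$ and $B_b\not\subseteq B_a$, and (ii) for every vertex $w\notin\{a,b\}$, $B_w\not\subseteq B_a\cup B_b$. $t(H)$ is the minimum $t$ for which an $H$-CFF$(t,|V(H)|)$ exists. $t(1,n)$ is the minimum $t$ such that there exist $n$ subsets of $[1,t]$ none contained in another; equivalently $t(1,n)=\min\{t:\binom{t}{\lfloor t/2\rfloor}\ge n\}$. *)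

theory Defs
  imports Main
begin

text \<open>A graph is a pair of a vertex set and a set of edges, each edge being an unordered pair.\<close>

type_synonym 'a graph = "'a set \<times> 'a set set"

abbreviation verts :: "'a graph \<Rightarrow> 'a set" where "verts G \<equiv> fst G"
abbreviation edges :: "'a graph \<Rightarrow> 'a set set" where "edges G \<equiv> snd G"

definition finite_simple_graph :: "'a graph \<Rightarrow> bool" where
  "finite_simple_graph G \<longleftrightarrow>
     finite (verts G) \<and> (\<forall>e\<in>edges G. e \<subseteq> verts G \<and> card e = 2)"

definition no_isolated_vertices :: "'a graph \<Rightarrow> bool" where
  "no_isolated_vertices G \<longleftrightarrow> (\<forall>v\<in>verts G. \<exists>u\<in>verts G. {v, u} \<in> edges G)"

definition add_universal_vertex :: "'a graph \<Rightarrow> 'a \<Rightarrow> 'a graph" where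
  "add_universal_vertex G x = (insert x (verts G), edges G \<union> {{x, v} | v. v \<in> verts G})"

text \<open>\<open>graph_cff H t B\<close>: the family \<open>B\<close>, restricted to the vertices of \<open>H\<close>, is an
  \<open>H\<close>-CFF\<open>(t, |V(H)|)\<close> on the ground set \<open>{1..t}\<close>.\<close>

definition graph_cff :: "'a graph \<Rightarrow> nat \<Rightarrow> ('a \<Rightarrow> nat set) \<Rightarrow> bool" where
  "graph_cff H t B \<longleftrightarrow>
     (\<forall>v\<in>verts H. B v \<subseteq> {1..t}) \<and>
     (\<forall>a b. {a, b} \<in> edges H \<longrightarrow>
        \<not> B a \<subseteq> B b \<and> \<not> B b \<subseteq> B a \<and>
        (\<forall>w\<in>verts H - {a, b}. \<not> B w \<subseteq> B a \<union> B b))"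

definition t_graph :: "'a graph \<Rightarrow> nat" where
  "t_graph H = (LEAST t. \<exists>B. graph_cff H t B)"

text \<open>\<open>t_one n\<close> is the number \<open>t(1,n)\<close>.\<close>

definition t_one :: "nat \<Rightarrow> nat" where
  "t_one n = (LEAST t. \<exists>B :: nat \<Rightarrow> nat set.
     (\<forall>i\<in>{1..n}. B i \<subseteq> {1..t}) \<and>
     (\<forall>i\<in>{1..n}. \<forall>j\<in>{1..n}. i \<noteq> j \<longrightarrow> \<not> B i \<subseteq> B j))"

text \<open>Both minima range over nonempty sets, so \<open>LEAST\<close> denotes a genuine minimum.\<close>

lemma graph_cff_exists:
  assumes "finite_simple_graph H"
  shows "\<exists>t B. graph_cff H t B"
proof -
  from assms have fin: "finite (verts H)"
    and E: "\<And>e. e \<in> edges H \<Longrightarrow> e \<subseteq> verts H \<and> card e = 2"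
    by (auto simp: finite_simple_graph_def)
  obtain f where f: "bij_betw f (verts H) {0..<card (verts H)}"
    using ex_bij_betw_finite_nat[OF fin] by blast
  have inj: "f u = f v \<longleftrightarrow> u = v" if "u \<in> verts H" "v \<in> verts H" for u v
    using f that by (auto simp: bij_betw_def inj_on_def)
  have "f v < card (verts H)" if "v \<in> verts H" for v
    using bij_betw_apply[OF f that] by simp
  moreover have "a \<in> verts H \<and> b \<in> verts H \<and> a \<noteq> b" if "{a, b} \<in> edges H" for a b
    using E[OF that] by auto
  ultimately have "graph_cff H (card (verts H)) (\<lambda>v. {Suc (f v)})"
    unfolding graph_cff_def by (auto simp: inj Suc_le_eq)
  then show ?thesis by blast
qed

lemma t_one_exists:
  "\<exists>t. \<exists>B :: nat \<Rightarrow> nat set. (\<forall>i\<in>{1..n}. B i \<subseteq> {1..t}) \<and>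
     (\<forall>i\<in>{1..n}. \<forall>j\<in>{1..n}. i \<noteq> j \<longrightarrow> \<not> B i \<subseteq> B j)"
  by (intro exI[of _ n] exI[of _ "\<lambda>i. {i}"]) auto

end

theory Submission imports Defs
begin

text \<open>Lower bound: an optimal family for \<open>G + {0}\<close> restricts to one for \<open>G\<close>, and since every
  vertex \<open>v\<close> is joined to \<open>0\<close>, the sets \<open>B v - B 0\<close> form an antichain on the ground set with the
  nonempty set \<open>B 0\<close> removed. Upper bound: give \<open>0\<close> the singleton of a new point; the edges at \<open>0\<close>
  then only require the given family to be an antichain, which holds as no vertex is isolated.\<close>

lemma t_graph_le:
  assumes "graph_cff H t B"
  shows "t_graph H \<le> t"
  unfolding t_graph_def using assms by (intro Least_le) blast

lemma t_graph_attained: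
  assumes "finite_simple_graph H"
  obtains B where "graph_cff H (t_graph H) B"
  using LeastI_ex[OF graph_cff_exists[OF assms]] that unfolding t_graph_def by blast

text \<open>A bijection from \<open>S\<close> to \<open>{1..card S}\<close> preserves non-inclusion,
  so antichains on any finite ground set bound \<open>t_one\<close>. This is needed because an
  interval with \<open>B 0\<close> removed need not be an interval.\<close>

lemma t_one_le_card:
  fixes B :: "nat \<Rightarrow> 'a set"
  assumes S: "finite S" "\<And>i. i \<in> {1..n} \<Longrightarrow> B i \<subseteq> S"
    and anti: "\<And>i j. i \<in> {1..n} \<Longrightarrow> j \<in> {1..n} \<Longrightarrow> i \<noteq> j \<Longrightarrow> \<not> B i \<subseteq> B j"
  shows "t_one n \<le> card S"
proof -
  obtain f where f: "bij_betw f S {1..card S}"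
    using S(1) by (metis finite_same_card_bij finite_atLeastAtMost card_atLeastAtMost diff_Suc_1)
  have sub: "f ` B i \<subseteq> {1..card S}" if "i \<in> {1..n}" for i
    using S(2)[OF that] f by (auto simp: bij_betw_def)
  have "\<not> f ` B i \<subseteq> f ` B j" if "i \<in> {1..n}" "j \<in> {1..n}" "i \<noteq> j" for i j
  proof -
    obtain y where "y \<in> B i" "y \<notin> B j" using anti[OF \<open>i \<in> _\<close> \<open>j \<in> _\<close> \<open>i \<noteq> j\<close>] by blast
    then have "f y \<notin> f ` B j"
      using inj_on_image_mem_iff[OF bij_betw_imp_inj_on[OF f]] S(2) that by blast
    with \<open>y \<in> B i\<close> show ?thesis by blast
  qed
  with sub show ?thesis
    unfolding t_one_def by (intro Least_le exI[of _ "\<lambda>i. f ` B i"]) blast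
qed

lemma finite_simple_graph_add_universal_vertex:
  assumes "finite_simple_graph G" "x \<notin> verts G"
  shows "finite_simple_graph (add_universal_vertex G x)"
  using assms by (fastforce simp: finite_simple_graph_def add_universal_vertex_def card_2_iff)

lemma graph_cff_add_universal_vertex_restrict:
  assumes "graph_cff (add_universal_vertex G x) t B"
  shows "graph_cff G t B"
  using assms unfolding graph_cff_def add_universal_vertex_def by simp

text \<open>Both facts come from the edge \<open>{x, v}\<close>. The first serves to show that
  \<open>B x\<close> is nonempty; the second amounts to \<open>B w - B x\<close> not lying inside
  \<open>B v - B x\<close>.\<close>

lemma graph_cff_add_universal_vertexD:
  assumes "graph_cff (add_universal_vertex G x) t B" "v \<in> verts G"
  shows "\<not> B x \<subseteq> B v"
    and "w \<in> verts G \<Longrightarrow> x \<notin> verts G \<Longrightarrow> w \<noteq> v \<Longrightarrow> \<not> B w \<subseteq> B x \<union> B v"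
proof -
  have "{x, v} \<in> edges (add_universal_vertex G x)"
    using assms(2) by (auto simp: add_universal_vertex_def)
  with assms(1) have *: "\<not> B x \<subseteq> B v"
    "\<And>w. w \<in> verts (add_universal_vertex G x) - {x, v} \<Longrightarrow> \<not> B w \<subseteq> B x \<union> B v"
    unfolding graph_cff_def by blast+
  show "\<not> B x \<subseteq> B v" by fact
  show "\<not> B w \<subseteq> B x \<union> B v" if "w \<in> verts G" "x \<notin> verts G" "w \<noteq> v"
    using that by (intro *(2)) (auto simp: add_universal_vertex_def)
qed

text \<open>Take a neighbour \<open>u\<close> of \<open>v\<close>. If \<open>u = w\<close>, this is
  the non-inclusion on an edge; otherwise \<open>w\<close> lies off the edge \<open>{v, u}\<close>,
  and not even \<open>B v \<union> B u\<close> covers \<open>B w\<close>.\<close>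

lemma graph_cff_not_subset:
  assumes "graph_cff G t B" "no_isolated_vertices G"
    and "v \<in> verts G" "w \<in> verts G" "v \<noteq> w"
  shows "\<not> B w \<subseteq> B v"
proof -
  obtain u where u: "u \<in> verts G" "{v, u} \<in> edges G"
    using assms(2,3) by (auto simp: no_isolated_vertices_def)
  show ?thesis
  proof (cases "u = w")
    case True
    then show ?thesis using u(2) assms(1) unfolding graph_cff_def by blast
  next
    case False
    then have "\<not> B w \<subseteq> B v \<union> B u"
      using u(2) assms(1,4,5) unfolding graph_cff_def by blast
    then show ?thesis by blast
  qed
qed

text \<open>The point \<open>t + 1\<close> lies in the set of \<open>x\<close> alone: old sets never
  cover it, and it never helps to cover an old set.\<close>

lemma graph_cff_add_universal_vertex:
  assumes cff: "graph_cff G t B" and G: "finite_simple_graph G" "no_isolated_vertices G"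
    and x: "x \<notin> verts G"
  shows "graph_cff (add_universal_vertex G x) (t + 1) (B(x := {t + 1}))"
proof -
  let ?B = "B(x := {t + 1})" and ?H = "add_universal_vertex G x"
  have B: "B v \<subseteq> {1..t}" if "v \<in> verts G" for v
    using cff that unfolding graph_cff_def by blast
  have new: "t + 1 \<notin> B v" if "v \<in> verts G" for v
    using B[OF that] by auto
  \<comment> \<open>An empty \<open>B v\<close> would be contained in the set of a neighbour.
    Nonemptiness keeps \<open>B v\<close> from lying inside \<open>{t + 1}\<close>, as the edge
    \<open>{x, v}\<close> requires.\<close>
  have ne: "B v \<noteq> {}" if "v \<in> verts G" for v
  proof -
    obtain u where "{v, u} \<in> edges G"
      using G(2) \<open>v \<in> verts G\<close> by (auto simp: no_isolated_vertices_def)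
    then show ?thesis using cff unfolding graph_cff_def by blast
  qed
  \<comment> \<open>Naming the edge condition makes its symmetry usable: a new edge need only be
    checked with \<open>x\<close> first.\<close>
  define good where "good a b \<longleftrightarrow> \<not> ?B a \<subseteq> ?B b \<and> \<not> ?B b \<subseteq> ?B a \<and>
    (\<forall>w\<in>verts ?H - {a, b}. \<not> ?B w \<subseteq> ?B a \<union> ?B b)" for a b
  have good_commute: "good a b \<longleftrightarrow> good b a" for a b
    unfolding good_def by (auto simp: insert_commute Un_commute)
  have good_x: "good x v" if v: "v \<in> verts G" for v
  proof -
    have "\<not> B w \<subseteq> {t + 1} \<union> B v" if "w \<in> verts G" "w \<noteq> v" for w
      using graph_cff_not_subset[OF cff G(2) v that(1)] that(2) new[OF that(1)] by blast
    moreover have "\<not> B v \<subseteq> {t + 1}" "v \<noteq> x"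
      using ne[OF v] new[OF v] v x by blast+
    ultimately show ?thesis
      using new[OF v] unfolding good_def by (auto simp: add_universal_vertex_def)
  qed
  have good_G: "good a b" if e: "{a, b} \<in> edges G" for a b
  proof -
    have ab: "a \<in> verts G" "b \<in> verts G" "a \<noteq> x" "b \<noteq> x"
      using e G(1) x unfolding finite_simple_graph_def by blast+
    \<comment> \<open>For an old edge the only additional outside vertex is \<open>x\<close>, and
      \<open>t + 1\<close> witnesses that its set is not covered.\<close>
    have "\<not> B a \<subseteq> B b" "\<not> B b \<subseteq> B a" "\<forall>w\<in>verts G - {a, b}. \<not> B w \<subseteq> B a \<union> B b"
      using e cff unfolding graph_cff_def by blast+
    then show ?thesis
      using ab new[OF ab(1)] new[OF ab(2)] x unfolding good_def
      by (auto simp: add_universal_vertex_def)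
  qed
  have "good a b" if "{a, b} \<in> edges ?H" for a b
    using that good_G good_x good_commute
    by (auto simp: add_universal_vertex_def doubleton_eq_iff)
  moreover have "?B v \<subseteq> {1..t + 1}" if "v \<in> verts ?H" for v
    using that subset_trans[OF B, of v "{1..t + 1}"] by (auto simp: add_universal_vertex_def)
  ultimately show ?thesis
    unfolding graph_cff_def good_def by blast
qed

theorem theorem4p15:
  fixes n :: nat and G :: "nat graph"
  assumes "n \<ge> 3"
    and "finite_simple_graph G"
    and "verts G = {1..n}"
    and "no_isolated_vertices G"
  shows "max (t_one n + 1) (t_graph G) \<le> t_graph (add_universal_vertex G 0)
       \<and> t_graph (add_universal_vertex G 0) \<le> t_graph G + 1"
proof -
  let ?H = "add_universal_vertex G 0"
  have x: "0 \<notin> verts G" using assms(3) by simp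
  obtain B where B: "graph_cff ?H (t_graph ?H) B"
    using t_graph_attained[OF finite_simple_graph_add_universal_vertex[OF assms(2) x]] .
  let ?T = "{1..t_graph ?H}"
  have sub: "B v \<subseteq> ?T" if "v \<in> verts ?H" for v
    using B that unfolding graph_cff_def by blast
  \<comment> \<open>Non-inclusion on the edge \<open>{0, 1}\<close> makes \<open>B 0\<close>
    nonempty, so removing it loses at least one point: the \<open>+ 1\<close> of the lower
    bound.\<close>
  have "1 \<in> verts G" using assms(1,3) by simp
  then have "B 0 \<noteq> {}" using graph_cff_add_universal_vertexD(1)[OF B] by blast
  moreover have "B 0 \<subseteq> ?T" using sub by (simp add: add_universal_vertex_def)
  ultimately have "card (?T - B 0) < card ?T"
    by (intro psubset_card_mono) auto
  moreover have "t_one n \<le> card (?T - B 0)"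
  proof (rule t_one_le_card)
    show "B i - B 0 \<subseteq> ?T - B 0" if "i \<in> {1..n}" for i
      using sub[of i] that assms(3) by (auto simp: add_universal_vertex_def)
    show "\<not> B i - B 0 \<subseteq> B j - B 0" if "i \<in> {1..n}" "j \<in> {1..n}" "i \<noteq> j" for i j
      \<comment> \<open>On the edge \<open>{0, j}\<close> with outside vertex \<open>i\<close>, a
        point of \<open>B i\<close> outside \<open>B 0 \<union> B j\<close> separates the two
        differences.\<close>
      using graph_cff_add_universal_vertexD(2)[OF B, of j i] that x assms(3) by blast
  qed simp
  ultimately have "t_one n + 1 \<le> t_graph ?H" by simp
  moreover have "t_graph G \<le> t_graph ?H"
    using t_graph_le[OF graph_cff_add_universal_vertex_restrict[OF B]] .
  moreover have "t_graph ?H \<le> t_graph G + 1"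
  proof -
    obtain C where "graph_cff G (t_graph G) C"
      using t_graph_attained[OF assms(2)] .
    then show ?thesis
      using t_graph_le[OF graph_cff_add_universal_vertex[OF _ assms(2,4) x]] by blast
  qed
  ultimately show ?thesis by simp
qed

end
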